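(* Fix graphical degrees $D_1\ge D_2\ge\dots\ge D_n$ and let $2|\mathsf E_n|=\sum_{i=1}^nD_i$. Let $\mathsf G_n$ and $\mathscr G_n$ be, respectively, the random multigraph generated by the configuration model and the uniformly chosen simple graph on $\{1,\dots,n\}$ with these degrees. There exists a coupling $\mu$ between the perfect matchings of half-edges which yield $\mathsf G_n$ and $\mathscr G_n$ such that the number $\mathsf\Delta_n\le 2|\mathsf E_n|$ of half-edges whose matching links are different between the two graphs satisfies $$\mathbb E_\mu\big[\mathsf\Delta_n(\mathsf\Delta_n-1)\big]\ \le\ 4\sum_{i=1}^{n-1}\ \sum_{j=i+1}^{i+D_i}\big(2D_iD_j-D_i-D_j\big),$$ where terms with $j>n$ in the inner sum are omitted.
   Context: Nonnegative integers $D_1,\dots,D_n$ are graphical if there is a simple graph (no loops, no multiple edges) on $\{1,\dots,n\}$ in which vertex $i$ has degree $D_i$. Equip vertex $i$ with $D_i$ half-edges, so that there are $2|\mathsf E_n|$ half-edges in total, each half-edge $e$ belonging to a vertex $v(e)$. A perfect matching $m$ of the half-edges (a fixed-point-free involution on the set of half-edges) yields a multigraph on $\{1,\dots,n\}$ with an edge $\{v(e),v(m(e))\}$ for each matched pair. $\mathsf G_n$ arises from a matching $\mathsf X$ uniform among all perfect matchings (configuration model); $\mathscr G_n$ arises from a matching $\mathsf Y$ uniform among those perfect matchings which yield a simple graph. A coupling $\mu$ is a joint law of $(\mathsf X,\mathsf Y)$ with these marginals, and $\mathsf\Delta_n=|\{e:\mathsf X(e)\ne\mathsf Y(e)\}|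$.
   Formalization: In the inner sum, terms with D_j = 0 are omitted as well as those with j > n; as printed, the bound fails for degrees (1,1,0), where the right-hand side is -4 and the left-hand side is 0. *)

theory Defs
  imports "HOL-Probability.Probability" "HOL-Combinatorics.Permutations" "HOL-Library.Multiset"
begin

definition graphical :: "nat \<Rightarrow> (nat \<Rightarrow> nat) \<Rightarrow> bool" where
  "graphical n D \<longleftrightarrow>
     (\<exists>E :: nat set set. (\<forall>e\<in>E. e \<subseteq> {1..n} \<and> card e = 2) \<and>
        (\<forall>i\<in>{1..n}. card {e \<in> E. i \<in> e} = D i))"

text \<open>The half-edge \<open>(i, k)\<close> is the \<open>k\<close>-th half-edge of vertex \<open>i\<close>; the vertex
  \<open>v(e)\<close> is thus \<open>fst e\<close>.\<close>

definition half_edges :: "nat \<Rightarrow> (nat \<Rightarrow> nat) \<Rightarrow> (nat \<times> nat) set" where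
  "half_edges n D = (SIGMA i:{1..n}. {..<D i})"

text \<open>\<open>permutes\<close> makes a matching the identity outside the set of half-edges, so that each
  perfect matching is represented by exactly one function.\<close>

definition perfect_matchings :: "'a set \<Rightarrow> ('a \<Rightarrow> 'a) set" where
  "perfect_matchings H = {m. m permutes H \<and> (\<forall>e\<in>H. m e \<noteq> e \<and> m (m e) = e)}"

text \<open>One edge for each matched pair \<open>{e, m e}\<close>, counted with multiplicity; a loop at \<open>i\<close> appears
  as the singleton \<open>{i}\<close>.\<close>

definition multigraph_of :: "('v \<times> 'b) set \<Rightarrow> ('v \<times> 'b \<Rightarrow> 'v \<times> 'b) \<Rightarrow> 'v set multiset" where
  "multigraph_of H m = image_mset (\<lambda>p. fst ` p) (mset_set ((\<lambda>e. {e, m e}) ` H))"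

definition simple_multigraph :: "'v set multiset \<Rightarrow> bool" where
  "simple_multigraph G \<longleftrightarrow> (\<forall>a \<in># G. card a = 2 \<and> count G a = 1)"

definition simple_matchings :: "('v \<times> 'b) set \<Rightarrow> ('v \<times> 'b \<Rightarrow> 'v \<times> 'b) set" where
  "simple_matchings H = {m \<in> perfect_matchings H. simple_multigraph (multigraph_of H m)}"

definition matching_coupling ::
    "nat \<Rightarrow> (nat \<Rightarrow> nat) \<Rightarrow> ((nat \<times> nat \<Rightarrow> nat \<times> nat) \<times> (nat \<times> nat \<Rightarrow> nat \<times> nat)) pmf \<Rightarrow> bool" where
  "matching_coupling n D \<mu> \<longleftrightarrow>
     map_pmf fst \<mu> = pmf_of_set (perfect_matchings (half_edges n D)) \<and>
     map_pmf snd \<mu> = pmf_of_set (simple_matchings (half_edges n D))"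

definition num_differing :: "'a set \<Rightarrow> ('a \<Rightarrow> 'a) \<Rightarrow> ('a \<Rightarrow> 'a) \<Rightarrow> nat" where
  "num_differing H x y = card {e \<in> H. x e \<noteq> y e}"

end

theory Submission
  imports Defs
begin

text \<open>The proof looks at one step of a Markov chain on pairs of matchings at a coupling that cannot be
  improved. Let \<open>N\<close> be the number of half-edges on which the two matchings differ. Couplings of two
  finitely supported distributions form a compact set, so there is a coupling \<open>\<mu>\<close> with minimal
  expectation of \<open>N\<close> (\<open>exists_optimal_coupling\<close>).

  Now draw an ordered pair \<open>(e, f)\<close> of distinct half-edges uniformly and switch both matchings at this
  pair: \<open>e\<close> and \<open>f\<close> become partners, and so do their old partners. In the second matching
  the switch is skipped when it would destroy simplicity. Both one-step chains preserve the uniform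
  distribution, because \<open>(m, e, f) \<mapsto> (switch e f m, e, m e)\<close> is an involution
  (\<open>uniform_switch_step\<close>, \<open>uniform_simple_switch_step\<close>). The result is again a coupling, so the
  expectation of \<open>N\<close> has not decreased.

  On the other hand, when both switches are carried out \<open>N\<close> never grows, and it drops by at least 2 if
  both \<open>e\<close> and \<open>f\<close> lie in the set of disagreement, which happens for \<open>N (N - 1)\<close> of the ordered
  pairs. A skipped switch costs at most 4 relative to this bound (\<open>sum_switch_num_differing_le\<close>). Comparing
  gain and cost at the optimal coupling yields that \<open>2 E[N (N - 1)]\<close> is at most 4 times the largest number of
  pairs whose switch is blocked in a simple matching (\<open>exists_coupling_num_differing_le\<close>).

  A switch is blocked only if it creates a loop or doubles an existing edge. Charging the loops at a
  vertex to the edges incident to it, one finds at most \<open>2 (2 a b - a - b)\<close> blocked pairs for each edge between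
  vertices of degrees \<open>a\<close> and \<open>b\<close> (\<open>card_blocked_pairs_le\<close>). Finally, vertex \<open>i\<close> has at most
  \<open>D i\<close> neighbours after it, and as the degrees decrease, the sum over them is largest when they are
  the immediate successors of \<open>i\<close> (\<open>sum_half_edges_le\<close>).\<close>

section \<open>Optimal couplings of finitely supported distributions\<close>

lemma pmf_map_fst_eq_sum:
  assumes "finite A" "finite B" "set_pmf \<nu> \<subseteq> A \<times> B"
  shows "pmf (map_pmf fst \<nu>) a = (\<Sum>b\<in>B. pmf \<nu> (a, b))"
proof -
  have "pmf (map_pmf fst \<nu>) a = measure \<nu> (fst -` {a} \<inter> set_pmf \<nu>)"
    by (simp add: pmf_map measure_Int_set_pmf)
  also have "fst -` {a} \<inter> set_pmf \<nu> = Pair a ` B \<inter> set_pmf \<nu>"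
    using assms(3) by force
  also have "measure \<nu> \<dots> = (\<Sum>z\<in>Pair a ` B. pmf \<nu> z)"
    using assms(2) by (simp add: measure_Int_set_pmf measure_measure_pmf_finite)
  also have "\<dots> = (\<Sum>b\<in>B. pmf \<nu> (a, b))"
    by (simp add: sum.reindex inj_on_def)
  finally show ?thesis .
qed

lemma pmf_map_snd_eq_sum:
  assumes "finite A" "finite B" "set_pmf \<nu> \<subseteq> A \<times> B"
  shows "pmf (map_pmf snd \<nu>) b = (\<Sum>a\<in>A. pmf \<nu> (a, b))"
proof -
  have "pmf (map_pmf snd \<nu>) b = measure \<nu> (snd -` {b} \<inter> set_pmf \<nu>)"
    by (simp add: pmf_map measure_Int_set_pmf)
  also have "snd -` {b} \<inter> set_pmf \<nu> = (\<lambda>a. (a, b)) ` A \<inter> set_pmf \<nu>"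
    using assms(3) by force
  also have "measure \<nu> \<dots> = (\<Sum>z\<in>(\<lambda>a. (a, b)) ` A. pmf \<nu> z)"
    using assms(1) by (simp add: measure_Int_set_pmf measure_measure_pmf_finite)
  also have "\<dots> = (\<Sum>a\<in>A. pmf \<nu> (a, b))"
    by (simp add: sum.reindex inj_on_def)
  finally show ?thesis .
qed

lemma set_pmf_coupling_subset:
  assumes "map_pmf fst \<nu> = p" "map_pmf snd \<nu> = q"
  shows "set_pmf \<nu> \<subseteq> set_pmf p \<times> set_pmf q"
  using assms by (force simp: set_map_pmf)

text \<open>Seen as vectors of point masses, the couplings form a closed subset of a cube, which is compact
  by Tychonoff's theorem, and the expected cost is a finite linear combination of coordinates.\<close>

lemma exists_optimal_coupling:
  fixes p :: "'a pmf" and q :: "'b pmf" and c :: "'a \<times> 'b \<Rightarrow> real"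
  assumes fin: "finite (set_pmf p)" "finite (set_pmf q)"
  shows "\<exists>\<mu>. map_pmf fst \<mu> = p \<and> map_pmf snd \<mu> = q \<and>
    (\<forall>\<nu>. map_pmf fst \<nu> = p \<longrightarrow> map_pmf snd \<nu> = q \<longrightarrow>
      measure_pmf.expectation \<mu> c \<le> measure_pmf.expectation \<nu> c)"
proof -
  define A B where "A = set_pmf p" and "B = set_pmf q"
  have fA: "finite A" and fB: "finite B" using fin by (auto simp: A_def B_def)
  \<comment> \<open>the point-mass functions of couplings; the marginal sums run over \<open>A\<close> and
    \<open>B\<close> only, so mass elsewhere has to be excluded separately\<close>
  define K where "K = {g :: 'a \<times> 'b \<Rightarrow> real. (\<forall>z. z \<notin> A \<times> B \<longrightarrow> g z = 0) \<and> (\<forall>z. 0 \<le> g z \<and> g z \<le> 1) \<and>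
     (\<forall>a. (\<Sum>b\<in>B. g (a, b)) = pmf p a) \<and> (\<forall>b. (\<Sum>a\<in>A. g (a, b)) = pmf q b)}"
  define cost where "cost = (\<lambda>g :: 'a \<times> 'b \<Rightarrow> real. \<Sum>z\<in>A \<times> B. g z * c z)"
  have pmf_in_K: "pmf \<nu> \<in> K" and cost_pmf: "cost (pmf \<nu>) = measure_pmf.expectation \<nu> c"
    if "map_pmf fst \<nu> = p" "map_pmf snd \<nu> = q" for \<nu>
  proof -
    have sub: "set_pmf \<nu> \<subseteq> A \<times> B"
      using set_pmf_coupling_subset[OF that] by (simp add: A_def B_def)
    show "pmf \<nu> \<in> K"
      using sub pmf_map_fst_eq_sum[OF fA fB sub] pmf_map_snd_eq_sum[OF fA fB sub] that
      by (auto simp: K_def pmf_le_1 set_pmf_iff)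
    show "cost (pmf \<nu>) = measure_pmf.expectation \<nu> c"
      using sub fA fB by (subst integral_measure_pmf[of "A \<times> B"]) (auto simp: cost_def)
  qed
  have "compact (PiE UNIV (\<lambda>_ :: 'a \<times> 'b. {0..1 :: real}))"
    using compactin_PiE[of "\<lambda>_. euclidean" UNIV "\<lambda>_ :: 'a \<times> 'b. {0..1 :: real}"]
    by (simp add: euclidean_product_topology)
  moreover have "closed K"
    unfolding K_def
    by (intro closed_Collect_conj closed_Collect_all closed_Collect_imp closed_Collect_le closed_Collect_eq
        continuous_on_sum continuous_on_product_coordinates continuous_on_const) auto
  moreover have "K \<subseteq> PiE UNIV (\<lambda>_ :: 'a \<times> 'b. {0..1 :: real})"
    by (auto simp: K_def)
  ultimately have "compact K"
    by (metis compact_Int_closed inf.absorb2)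
  moreover have "K \<noteq> {}"
    using pmf_in_K[of "pair_pmf p q"] by (auto simp: map_fst_pair_pmf map_snd_pair_pmf)
  moreover have "continuous_on K cost"
    unfolding cost_def
    by (intro continuous_on_sum continuous_on_mult continuous_on_const
        continuous_on_subset[OF continuous_on_product_coordinates]) auto
  ultimately obtain g where g: "g \<in> K" "\<And>h. h \<in> K \<Longrightarrow> cost g \<le> cost h"
    using continuous_attains_inf[of K cost] by blast
  have g0: "\<And>z. z \<notin> A \<times> B \<Longrightarrow> g z = 0" and gnn: "\<And>z. 0 \<le> g z"
    and gA: "\<And>a. (\<Sum>b\<in>B. g (a, b)) = pmf p a" and gB: "\<And>b. (\<Sum>a\<in>A. g (a, b)) = pmf q b"
    using g(1) by (auto simp: K_def)
  have "(\<Sum>z\<in>A \<times> B. g z) = (\<Sum>a\<in>A. \<Sum>b\<in>B. g (a, b))"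
    by (simp add: sum.cartesian_product)
  also have "\<dots> = (\<Sum>a\<in>A. pmf p a)"
    by (simp add: gA)
  also have "\<dots> = 1" using fA by (intro sum_pmf_eq_1) (auto simp: A_def)
  finally have "(\<Sum>z\<in>A \<times> B. g z) = 1" .
  moreover have "(\<integral>\<^sup>+ z. ennreal (g z) \<partial>count_space UNIV) = (\<Sum>z\<in>A \<times> B. ennreal (g z))"
    using g0 fA fB by (intro nn_integral_count_space') (auto simp del: mem_Sigma_iff)
  ultimately have "(\<integral>\<^sup>+ z. ennreal (g z) \<partial>count_space UNIV) = 1"
    by (simp add: sum_ennreal gnn)
  then have pmf_g: "pmf (embed_pmf g) z = g z" for z
    by (simp add: pmf_embed_pmf gnn)
  define \<mu> where "\<mu> = embed_pmf g"
  have pmf_\<mu>: "pmf \<mu> = g" using pmf_g by (simp add: \<mu>_def fun_eq_iff)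
  have sub: "set_pmf \<mu> \<subseteq> A \<times> B"
    by (metis g0 pmf_\<mu> set_pmf_iff subsetI)
  have marg: "map_pmf fst \<mu> = p" "map_pmf snd \<mu> = q"
    using pmf_map_fst_eq_sum[OF fA fB sub] pmf_map_snd_eq_sum[OF fA fB sub]
    by (auto intro!: pmf_eqI simp: pmf_\<mu> gA gB)
  show ?thesis
    using marg g(2) pmf_in_K cost_pmf cost_pmf[OF marg] pmf_\<mu> by metis
qed

section \<open>Random steps that preserve uniformity\<close>

text \<open>A random step chosen through an independent uniform label is uniform again as soon as it is the
  first component of a permutation of states and labels jointly, even if the steps with a fixed
  label fail to be injective.\<close>

lemma uniform_step_of_involution:
  assumes fin: "finite A" "finite P" and ne: "A \<noteq> {}" "P \<noteq> {}"
    and T: "\<And>z. z \<in> A \<times> P \<Longrightarrow> T z \<in> A \<times> P" "\<And>z. z \<in> A \<times> P \<Longrightarrow> T (T z) = z"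
  shows "pmf_of_set A \<bind> (\<lambda>a. map_pmf (\<lambda>p. fst (T (a, p))) (pmf_of_set P)) = pmf_of_set A"
proof -
  have "A \<times> P \<noteq> {}" "finite (A \<times> P)" using fin ne by auto
  note prod = pmf_of_set[OF this]
  have pair: "pair_pmf (pmf_of_set A) (pmf_of_set P) = pmf_of_set (A \<times> P)"
    by (intro pmf_eqI) (auto simp: prod pmf_pair pmf_of_set[OF ne(1) fin(1)] pmf_of_set[OF ne(2) fin(2)]
        indicator_def card_cartesian_product)
  have "pmf_of_set A \<bind> (\<lambda>a. map_pmf (\<lambda>p. fst (T (a, p))) (pmf_of_set P))
      = map_pmf fst (map_pmf T (pair_pmf (pmf_of_set A) (pmf_of_set P)))"
    by (simp add: pair_pmf_def map_pmf_def bind_assoc_pmf bind_return_pmf)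
  also have "map_pmf T (pair_pmf (pmf_of_set A) (pmf_of_set P)) = pmf_of_set (A \<times> P)"
    unfolding pair
    using bij_betw_byWitness[of "A \<times> P" T T "A \<times> P"] T fin ne
    by (intro map_pmf_of_set_bij_betw) (blast | simp)+
  also have "map_pmf fst \<dots> = pmf_of_set A"
    by (simp flip: pair add: map_fst_pair_pmf)
  finally show ?thesis .
qed

section \<open>Switching a perfect matching\<close>

lemma perfect_matchingsD:
  assumes "m \<in> perfect_matchings H"
  shows "m (m e) = e" and "m e \<in> H \<longleftrightarrow> e \<in> H" and "e \<in> H \<Longrightarrow> m e \<noteq> e"
  using assms by (cases "e \<in> H"; auto simp: perfect_matchings_def permutes_in_image permutes_not_in)+

lemma finite_perfect_matchings: "finite H \<Longrightarrow> finite (perfect_matchings H)"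
  unfolding perfect_matchings_def by (rule finite_subset[OF _ finite_permutations[of H]]) auto

text \<open>The switch matches \<open>e\<close> with \<open>f\<close> and \<open>m e\<close> with \<open>m f\<close>. It amounts to exchanging the roles of the
  half-edges \<open>m e\<close> and \<open>f\<close>, and writing it as a conjugation makes it evident that the result is a
  perfect matching and that the same transposition undoes it. If \<open>f\<close> is already the
  partner of \<open>e\<close>, the transposition is the identity.\<close>

definition switch :: "'a \<Rightarrow> 'a \<Rightarrow> ('a \<Rightarrow> 'a) \<Rightarrow> 'a \<Rightarrow> 'a" where
  "switch e f m = Transposition.transpose (m e) f \<circ> m \<circ> Transposition.transpose (m e) f"

lemma switch_in_perfect_matchings:
  assumes m: "m \<in> perfect_matchings H" and "e \<in> H" "f \<in> H"
  shows "switch e f m \<in> perfect_matchings H"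
proof -
  have "m e \<in> H" using perfect_matchingsD[OF m] assms by auto
  then have t: "Transposition.transpose (m e) f permutes H" using assms by (intro permutes_swap_id)
  have "m permutes H" using m by (simp add: perfect_matchings_def)
  then have "switch e f m permutes H"
    unfolding switch_def by (intro permutes_compose t)
  moreover have "switch e f m h \<noteq> h \<and> switch e f m (switch e f m h) = h" if "h \<in> H" for h
  proof -
    have "m (Transposition.transpose (m e) f h) \<noteq> Transposition.transpose (m e) f h"
      using perfect_matchingsD(3)[OF m] permutes_in_image[OF t] that by blast
    then have "switch e f m h \<noteq> h"
      unfolding switch_def comp_def by (metis transpose_involutory)
    then show ?thesis
      by (simp add: switch_def perfect_matchingsD(1)[OF m])
  qed
  ultimately show ?thesis by (simp add: perfect_matchings_def)
qed

lemma switch_apply: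
  assumes "m \<in> perfect_matchings H" "e \<in> H" "f \<in> H" "e \<noteq> f"
  shows "switch e f m h =
    (if h = e then f else if h = f then e else if h = m e then m f else if h = m f then m e else m h)"
proof -
  note M = perfect_matchingsD[OF assms(1)]
  have inj: "m a = m b \<longleftrightarrow> a = b" for a b using M(1) by metis
  have neq: "m e \<noteq> e" "m f \<noteq> f" using M(3) assms by auto
  consider "h = e" | "h = f" | "h = m e" "h \<noteq> f" | "h = m f" "h \<noteq> e"
    | "h \<noteq> e" "h \<noteq> f" "h \<noteq> m e" "h \<noteq> m f"
    by blast
  then show ?thesis
  proof cases
    case 5
    then have "m h \<noteq> m e" "m h \<noteq> f" "m h \<noteq> e" using inj M(1) by metis+
    then show ?thesis using 5 by (simp add: switch_def)
  next
    case 3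
    then have "m f \<noteq> m e" using inj assms by simp
    with 3 show ?thesis using neq assms M(1) by (auto simp: switch_def)
  next
    case 4
    then have "h \<noteq> m e" using inj assms by simp
    with 4 show ?thesis using neq assms M(1) by (auto simp: switch_def)
  qed (use neq assms M(1) in \<open>auto simp: switch_def Transposition.transpose_def\<close>)
qed

text \<open>After the switch \<open>e\<close> has partner \<open>f\<close>, so asking for the old partner of \<open>e\<close> conjugates with the same
  transposition once more.\<close>

lemma switch_switch:
  assumes "m \<in> perfect_matchings H" "e \<in> H" "f \<in> H" "e \<noteq> f"
  shows "switch e (m e) (switch e f m) = m"
proof -
  have "switch e f m e = f" by (simp add: switch_apply[OF assms])
  then have "switch e (m e) (switch e f m) = Transposition.transpose f (m e) \<circ> switch e f m \<circ> Transposition.transpose f (m e)"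
    by (simp add: switch_def[of e "m e"])
  then show ?thesis
    by (simp add: switch_def fun_eq_iff Transposition.transpose_commute[of f])
qed

text \<open>The set of half-edges on which two matchings disagree is closed under both matchings.\<close>

lemma differing_partners:
  assumes x: "x \<in> perfect_matchings H" and y: "y \<in> perfect_matchings H"
  shows "x (x h) = y (x h) \<longleftrightarrow> x h = y h" and "x (y h) = y (y h) \<longleftrightarrow> x h = y h"
  using perfect_matchingsD(1)[OF x] perfect_matchingsD(1)[OF y]
  by metis+

text \<open>If the matchings agree at \<open>e\<close>, both are conjugated by the same transposition and the set of disagreement
  is merely relabelled. Otherwise \<open>e\<close> leaves it. If they agree at \<open>f\<close>, the common partner of
  \<open>f\<close> may enter in exchange; if they disagree at \<open>f\<close> as well, all half-edges involved were already
  points of disagreement, nothing enters, and both \<open>e\<close> and \<open>f\<close> leave.\<close>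

lemma num_differing_switch_le:
  assumes fin: "finite H"
    and x: "x \<in> perfect_matchings H" and y: "y \<in> perfect_matchings H"
    and ef: "e \<in> H" "f \<in> H" "e \<noteq> f"
  shows "num_differing H (switch e f x) (switch e f y) + (if x e \<noteq> y e \<and> x f \<noteq> y f then 2 else 0)
    \<le> num_differing H x y"
proof -
  let ?N = "{h \<in> H. x h \<noteq> y h}" and ?N' = "{h \<in> H. switch e f x h \<noteq> switch e f y h}"
  have finN: "finite ?N" using fin by simp
  note X = perfect_matchingsD[OF x] and Y = perfect_matchingsD[OF y]
  note partners = differing_partners[OF x y]
  note sx = switch_apply[OF x ef] and sy = switch_apply[OF y ef]
  consider (agree) "x e = y e" | (first) "x e \<noteq> y e" "x f = y f" | (both) "x e \<noteq> y e" "x f \<noteq> y f"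
    by blast
  then show ?thesis
  proof cases
    case agree
    let ?t = "Transposition.transpose (y e) f"
    have "y e \<in> H" using Y ef by auto
    then have "?t h \<in> H \<longleftrightarrow> h \<in> H" for h using ef by (auto simp: Transposition.transpose_def)
    moreover have "switch e f x h \<noteq> switch e f y h \<longleftrightarrow> x (?t h) \<noteq> y (?t h)" for h
      by (auto simp: switch_def agree dest: Transposition.transpose_eq_imp_eq)
    ultimately have "?N' = ?t -` ?N" by auto
    also have "\<dots> = ?t ` ?N"
      using bij_vimage_eq_inv_image[of ?t ?N] by simp
    finally have "card ?N' = card ?N" by (simp add: card_image)
    then show ?thesis using agree by (simp add: num_differing_def)
  next
    case first
    have "?N' \<subseteq> insert (x f) (?N - {e})"
    proof (rule subsetI)
      fix h assume "h \<in> ?N'"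
      then have h: "h \<in> H" "switch e f x h \<noteq> switch e f y h" by auto
      have "x h \<noteq> y h" if "h \<noteq> x f"
      proof
        assume agree: "x h = y h"
        then have "h \<noteq> e" "h \<noteq> x e" "h \<noteq> y e"
          using first partners[of e] by auto
        with h(2) that agree first(2) show False by (simp add: sx sy split: if_splits)
      qed
      moreover have "h \<noteq> e" using h(2) by (auto simp: sx sy)
      ultimately show "h \<in> insert (x f) (?N - {e})" using h(1) by auto
    qed
    then have "card ?N' \<le> card (insert (x f) (?N - {e}))"
      using finN by (intro card_mono) auto
    also have "\<dots> \<le> card (?N - {e}) + 1"
      using card_insert_le_m1[of "card (?N - {e}) + 1" "?N - {e}" "x f"] by simp
    also have "\<dots> = card ?N"
      using finN first ef card_Suc_Diff1[of ?N e] by simp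
    finally show ?thesis using first by (simp add: num_differing_def)
  next
    case both
    have "?N' \<subseteq> ?N - {e, f}"
    proof (rule subsetI)
      fix h assume "h \<in> ?N'"
      then have h: "h \<in> H" "switch e f x h \<noteq> switch e f y h" by auto
      have "x h \<noteq> y h"
      proof
        assume agree: "x h = y h"
        then have "h \<notin> {e, f, x e, y e, x f, y f}"
          using both partners[of e] partners[of f] by auto
        with h(2) agree show False by (simp add: sx sy)
      qed
      moreover have "h \<noteq> e" "h \<noteq> f" using h(2) ef(3) by (auto simp: sx sy)
      ultimately show "h \<in> ?N - {e, f}" using h(1) by auto
    qed
    then have "card ?N' \<le> card (?N - {e, f})"
      using finN by (intro card_mono) auto
    also have "card (?N - {e, f}) = card ?N - 2"
      using both ef finN by (subst card_Diff_subset) auto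
    finally have "card ?N' \<le> card ?N - 2" .
    moreover have "2 \<le> card ?N"
      using card_mono[of ?N "{e, f}"] finN both ef by auto
    ultimately show ?thesis using both by (simp add: num_differing_def)
  qed
qed

text \<open>A switch changes only the partners of \<open>e\<close>, \<open>f\<close>, \<open>x e\<close> and \<open>x f\<close>. If \<open>e\<close> and \<open>f\<close> are points of disagreement
  then so are all four, and no new ones arise. The summand 2 mirrors the gain in
  \<open>num_differing_switch_le\<close>, so that the two bounds differ by exactly 4.\<close>

lemma num_differing_switch_left_le:
  assumes fin: "finite H"
    and x: "x \<in> perfect_matchings H" and y: "y \<in> perfect_matchings H"
    and ef: "e \<in> H" "f \<in> H" "e \<noteq> f"
  shows "num_differing H (switch e f x) y + (if x e \<noteq> y e \<and> x f \<noteq> y f then 2 else 0)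
    \<le> num_differing H x y + 4"
proof -
  let ?N = "{h \<in> H. x h \<noteq> y h}" and ?N' = "{h \<in> H. switch e f x h \<noteq> y h}"
  have finN: "finite ?N" using fin by simp
  note X = perfect_matchingsD[OF x] and Y = perfect_matchingsD[OF y]
  note partners = differing_partners[OF x y]
  note sx = switch_apply[OF x ef]
  have sub: "?N' \<subseteq> ?N \<union> {e, f, x e, x f}"
    by (auto simp: sx split: if_splits)
  show ?thesis
  proof (cases "x e \<noteq> y e \<and> x f \<noteq> y f")
    case True
    then have "{e, f, x e, x f} \<subseteq> ?N" using X ef partners[of e] partners[of f] by auto
    with sub have "?N' \<subseteq> ?N" by blast
    then have "card ?N' \<le> card ?N" using finN by (rule card_mono[rotated])
    then show ?thesis by (simp add: num_differing_def)
  next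
    case False
    have "card ?N' \<le> card (?N \<union> {e, f, x e, x f})" using sub finN by (intro card_mono) auto
    also have "\<dots> \<le> card ?N + card {e, f, x e, x f}" by (rule card_Un_le)
    also have "card {e, f, x e, x f} \<le> 4" by (simp add: card_insert_if)
    finally show ?thesis using False by (auto simp: num_differing_def)
  qed
qed

section \<open>Switches that destroy simplicity\<close>

text \<open>Two matched pairs with the same end vertices may be aligned in two ways. The condition on
  \<open>e\<close> and \<open>f\<close> covers both, since one may pass from \<open>f\<close> to its partner.\<close>

lemma simple_matchings_iff:
  assumes fin: "finite H"
  shows "m \<in> simple_matchings H \<longleftrightarrow> m \<in> perfect_matchings H \<and>
    (\<forall>e\<in>H. fst (m e) \<noteq> fst e) \<and>
    (\<forall>e\<in>H. \<forall>f\<in>H. fst e = fst f \<longrightarrow> fst (m e) = fst (m f) \<longrightarrow> e = f)"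
proof (cases "m \<in> perfect_matchings H")
  case True
  note M = perfect_matchingsD[OF True]
  let ?L = "(\<lambda>e. {e, m e}) ` H"
  have finL: "finite ?L" using fin by simp
  have count: "count (multigraph_of H m) a = card {p \<in> ?L. fst ` p = a}" for a
    using finL by (simp add: multigraph_of_def count_image_mset' sum.If_cases Int_def
        conj_commute) (metis (no_types, lifting))
  have edges: "set_mset (multigraph_of H m) = (\<lambda>e. {fst e, fst (m e)}) ` H"
    using finL by (simp add: multigraph_of_def image_image)
  have "simple_multigraph (multigraph_of H m) \<longleftrightarrow>
    (\<forall>e\<in>H. fst (m e) \<noteq> fst e \<and> card {p \<in> ?L. fst ` p = {fst e, fst (m e)}} = 1)"
    by (auto simp: simple_multigraph_def edges count card_insert_if)
  also have "\<dots> \<longleftrightarrow> (\<forall>e\<in>H. fst (m e) \<noteq> fst e) \<and>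
    (\<forall>e\<in>H. \<forall>f\<in>H. fst e = fst f \<longrightarrow> fst (m e) = fst (m f) \<longrightarrow> e = f)"
  proof (intro iffI conjI ballI impI)
    fix e f
    assume *: "\<forall>e\<in>H. fst (m e) \<noteq> fst e \<and> card {p \<in> ?L. fst ` p = {fst e, fst (m e)}} = 1"
      and e: "e \<in> H" and f: "f \<in> H" and eq: "fst e = fst f" "fst (m e) = fst (m f)"
    have "{e, m e} \<in> {p \<in> ?L. fst ` p = {fst e, fst (m e)}}"
      "{f, m f} \<in> {p \<in> ?L. fst ` p = {fst e, fst (m e)}}"
      using e f eq by auto
    moreover obtain p where "{p \<in> ?L. fst ` p = {fst e, fst (m e)}} = {p}"
      using * e by (meson card_1_singletonE)
    ultimately have "{e, m e} = {f, m f}" by auto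
    then show "e = f" using * e eq by (auto simp: doubleton_eq_iff)
  next
    fix e
    assume *: "(\<forall>e\<in>H. fst (m e) \<noteq> fst e) \<and>
      (\<forall>e\<in>H. \<forall>f\<in>H. fst e = fst f \<longrightarrow> fst (m e) = fst (m f) \<longrightarrow> e = f)" and e: "e \<in> H"
    show "fst (m e) \<noteq> fst e" using * e by simp
    have "{f, m f} = {e, m e}" if f: "f \<in> H" and "fst ` {f, m f} = {fst e, fst (m e)}" for f
    proof -
      consider "fst f = fst e" "fst (m f) = fst (m e)" | "fst f = fst (m e)" "fst (m f) = fst e"
        using \<open>fst ` {f, m f} = _\<close> by (auto simp: doubleton_eq_iff)
      then show ?thesis
      proof cases
        case 1
        then have "f = e" using * e f by blast
        then show ?thesis by simp
      next
        case 2
        moreover have "m e \<in> H" "fst (m (m e)) = fst e" using M e by auto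
        ultimately have "f = m e" using * f by metis
        then show ?thesis using M by auto
      qed
    qed
    then have "p = {e, m e}" if "p \<in> {p \<in> ?L. fst ` p = {fst e, fst (m e)}}" for p
      using that by blast
    moreover have "{e, m e} \<in> {p \<in> ?L. fst ` p = {fst e, fst (m e)}}" using e by simp
    ultimately have "{p \<in> ?L. fst ` p = {fst e, fst (m e)}} = {{e, m e}}" by blast
    then show "card {p \<in> ?L. fst ` p = {fst e, fst (m e)}} = 1" by simp
  qed auto
  finally show ?thesis using True by (simp add: simple_matchings_def)
qed (simp add: simple_matchings_def)

definition distinct_pairs :: "'a set \<Rightarrow> ('a \<times> 'a) set" where
  "distinct_pairs H = {(e, f). e \<in> H \<and> f \<in> H \<and> e \<noteq> f}"

definition blocked_pairs :: "('v \<times> 'b) set \<Rightarrow> ('v \<times> 'b \<Rightarrow> 'v \<times> 'b) \<Rightarrow> (('v \<times> 'b) \<times> ('v \<times> 'b)) set" where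
  "blocked_pairs H m = {(e, f) \<in> distinct_pairs H. switch e f m \<notin> simple_matchings H}"

definition loop_pairs :: "('v \<times> 'b) set \<Rightarrow> (('v \<times> 'b) \<times> ('v \<times> 'b)) set" where
  "loop_pairs H = {(e, f) \<in> distinct_pairs H. fst e = fst f}"

text \<open>The pairs for which the new edge through \<open>e\<close> and \<open>f\<close> would be parallel to an edge, given by the half-edge
  \<open>g\<close>, that survives the switch. If \<open>g = e\<close> or \<open>m g = f\<close>, that edge is removed by the switch itself.\<close>

definition parallel_pairs ::
    "('v \<times> 'b) set \<Rightarrow> ('v \<times> 'b \<Rightarrow> 'v \<times> 'b) \<Rightarrow> (('v \<times> 'b) \<times> ('v \<times> 'b)) set" where
  "parallel_pairs H m = {(e, f). e \<in> H \<and> f \<in> H \<and>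
     (\<exists>g\<in>H. fst g = fst e \<and> g \<noteq> e \<and> fst (m g) = fst f \<and> m g \<noteq> f)}"

lemma finite_distinct_pairs: "finite H \<Longrightarrow> finite (distinct_pairs H)"
  by (rule finite_subset[of _ "H \<times> H"]) (auto simp: distinct_pairs_def)

lemma card_distinct_pairs: "finite H \<Longrightarrow> card (distinct_pairs H) = card H * (card H - 1)"
proof -
  assume fin: "finite H"
  have "distinct_pairs H = (SIGMA e:H. H - {e})"
    by (auto simp: distinct_pairs_def)
  then show ?thesis using fin by (simp add: card_SigmaI)
qed

text \<open>A switch creates the two edges \<open>{e, f}\<close> and \<open>{m e, m f}\<close>, which explains the images under \<open>m\<close>. The two new
  edges are never parallel to each other unless the switch is trivial: aligned as \<open>e\<close> with \<open>m f\<close> they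
  would come from two parallel edges of \<open>m\<close>, and in the other alignment \<open>{e, m e}\<close> would be a loop of \<open>m\<close>.\<close>

lemma blocked_pairs_subset:
  assumes fin: "finite H" and m: "m \<in> simple_matchings H"
  shows "blocked_pairs H m \<subseteq>
    loop_pairs H \<union> map_prod m m ` loop_pairs H \<union> parallel_pairs H m \<union> map_prod m m ` parallel_pairs H m"
proof (rule subrelI, rule ccontr)
  fix e f
  assume "(e, f) \<in> blocked_pairs H m"
  then have ef: "e \<in> H" "f \<in> H" "e \<noteq> f" and ns: "switch e f m \<notin> simple_matchings H"
    by (auto simp: blocked_pairs_def distinct_pairs_def)
  have pm: "m \<in> perfect_matchings H" and noloop: "\<And>h. h \<in> H \<Longrightarrow> fst (m h) \<noteq> fst h"
    and nopar: "\<And>h k. h \<in> H \<Longrightarrow> k \<in> H \<Longrightarrow> fst h = fst k \<Longrightarrow> fst (m h) = fst (m k) \<Longrightarrow> h = k"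
    using m by (auto simp: simple_matchings_iff[OF fin])
  note M = perfect_matchingsD[OF pm]
  note s = switch_apply[OF pm ef]
  have inM: "m e \<in> H" "m f \<in> H" using M ef by auto
  assume "(e, f) \<notin> loop_pairs H \<union> map_prod m m ` loop_pairs H \<union> parallel_pairs H m \<union> map_prod m m ` parallel_pairs H m"
  then have L1: "(e, f) \<notin> loop_pairs H" and "(e, f) \<notin> map_prod m m ` loop_pairs H"
    and P1: "(e, f) \<notin> parallel_pairs H m" and "(e, f) \<notin> map_prod m m ` parallel_pairs H m" by auto
  moreover have "(e, f) = map_prod m m (m e, m f)" using M by simp
  ultimately have L2: "(m e, m f) \<notin> loop_pairs H" and P2: "(m e, m f) \<notin> parallel_pairs H m"
    by blast+
  have l1: "fst e \<noteq> fst f" and l2: "fst (m e) \<noteq> fst (m f)"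
    using L1 L2 ef inM M(1)[of e] M(1)[of f] by (auto simp: loop_pairs_def distinct_pairs_def)
  have p1: "g = e \<or> m g = f" if "g \<in> H" "fst g = fst e" "fst (m g) = fst f" for g
    using P1 ef that by (auto simp: parallel_pairs_def)
  have p2: "g = m e \<or> m g = m f" if "g \<in> H" "fst g = fst (m e)" "fst (m g) = fst (m f)" for g
    using P2 inM that unfolding parallel_pairs_def by blast
  let ?s = "switch e f m"
  have "m e = m f \<longleftrightarrow> e = f" "m e = f \<longrightarrow> m f = e" "m f = e \<longrightarrow> m e = f" using M(1) by metis+
  then have vals: "?s e = f" "?s f = e" "?s (m e) = m f" "?s (m f) = m e"
    using M(3) ef by (auto simp: s)
  have "fst (?s h) \<noteq> fst h" if "h \<in> H" for h
    using l1 l2 noloop[OF that] by (auto simp: s)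
  moreover have "h = k" if hk: "h \<in> H" "k \<in> H" "fst h = fst k" "fst (?s h) = fst (?s k)" for h k
  proof -
    have old_new: False
      if h: "h \<in> {e, f, m e, m f}" and k: "k \<notin> {e, f, m e, m f}" "k \<in> H"
        and eq: "fst h = fst k" "fst (?s h) = fst (?s k)" for h k
    proof -
      have sk: "?s k = m k" using k by (simp add: s)
      have "m k = a \<longleftrightarrow> k = m a" for a using M(1) by metis
      then have mk: "m k \<notin> {e, f, m e, m f}" using k(1) M(1) by simp
      have mkH: "m k \<in> H" and mmk: "m (m k) = k" using k M(1,2) by auto
      consider "h = e" "?s h = f" | "h = f" "?s h = e" | "h = m e" "?s h = m f" | "h = m f" "?s h = m e"
        using h vals by blast
      then show False
      proof cases
        case 1
        then have "k = e \<or> m k = f" using eq k sk by (intro p1) auto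
        then show False using k mk by auto
      next
        case 2
        then have "m k = e \<or> m (m k) = f"
          using eq sk mkH mmk by (intro p1) auto
        then show False using k mk mmk by auto
      next
        case 3
        then have "k = m e \<or> m k = m f" using eq k sk by (intro p2) auto
        then show False using k mk by auto
      next
        case 4
        then have "m k = m e \<or> m (m k) = m f"
          using eq sk mkH mmk by (intro p2) auto
        then show False using k mk mmk by auto
      qed
    qed
    consider (old) "h \<notin> {e, f, m e, m f}" "k \<notin> {e, f, m e, m f}"
      | (new) "h \<in> {e, f, m e, m f}" "k \<in> {e, f, m e, m f}"
      using old_new[of h k] old_new[of k h] hk by metis
    then show ?thesis
    proof cases
      case old
      then show ?thesis using hk nopar by (simp add: s)
    next
      case new
      \<comment> \<open>parallel new edges come from parallel old ones, so there is only one edge involved\<close>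
      have cross: "m f = e \<and> m e = f" if "fst e = fst (m f)" "fst (m e) = fst f"
        using nopar[of e "m f"] that ef inM M(1) by metis
      have ne: "fst e \<noteq> fst (m e)" "fst f \<noteq> fst (m f)" using noloop ef by metis+
      have "h = k \<or> (h = e \<and> k = f \<or> h = f \<and> k = e) \<or> (h = e \<and> k = m e \<or> h = m e \<and> k = e) \<or> (h = e \<and> k = m f \<or> h = m f \<and> k = e) \<or>
        (h = f \<and> k = m e \<or> h = m e \<and> k = f) \<or> (h = f \<and> k = m f \<or> h = m f \<and> k = f) \<or> (h = m e \<and> k = m f \<or> h = m f \<and> k = m e)"
        using new by (elim insertE emptyE) simp_all
      then consider "h = k" | "h = e \<and> k = f \<or> h = f \<and> k = e" | "h = e \<and> k = m e \<or> h = m e \<and> k = e" | "h = e \<and> k = m f \<or> h = m f \<and> k = e"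
        | "h = f \<and> k = m e \<or> h = m e \<and> k = f" | "h = f \<and> k = m f \<or> h = m f \<and> k = f" | "h = m e \<and> k = m f \<or> h = m f \<and> k = m e"
        by (elim disjE) iprover+
      then show ?thesis
      proof cases
        case 4
        then have "fst e = fst (m f)" "fst f = fst (m e)" using hk(3,4) vals by (elim disjE; simp)+
        then show ?thesis using 4 cross by auto
      next
        case 5
        then have "fst e = fst (m f)" "fst f = fst (m e)" using hk(3,4) vals by (elim disjE; simp)+
        then show ?thesis using 5 cross by auto
      qed (use hk(3) l1 l2 ne in auto)
    qed
  qed
  moreover have "?s \<in> perfect_matchings H"
    using switch_in_perfect_matchings[OF pm ef(1,2)] .
  ultimately show False using ns by (simp add: simple_matchings_iff[OF fin])
qed

text \<open>With \<open>a\<close> and \<open>b\<close> denoting the degrees minus one at the two ends of the edge through \<open>g\<close>, there are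
  at most \<open>\<Sum>g. a g * b g\<close> pairs that double an edge. There are \<open>\<Sum>g. a g\<close> pairs that form a loop, and
  this equals half of \<open>\<Sum>g. a g + b g\<close> because \<open>m\<close> permutes the half-edges. Both kinds count twice, once for each new
  edge, and \<open>2 a b + a + b\<close> is the summand of the claim in terms of degrees.\<close>

lemma card_blocked_pairs_le:
  assumes fin: "finite H" and m: "m \<in> simple_matchings H"
    and deg: "\<And>h. h \<in> H \<Longrightarrow> card {k \<in> H. fst k = fst h} = d (fst h)"
  shows "real (card (blocked_pairs H m)) \<le>
    (\<Sum>g\<in>H. 2 * real (d (fst g)) * real (d (fst (m g))) - real (d (fst g)) - real (d (fst (m g))))"
proof -
  have pm: "m \<in> perfect_matchings H" using m by (simp add: simple_matchings_def)
  note M = perfect_matchingsD[OF pm]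
  define a b where "a g = real (d (fst g)) - 1" and "b g = real (d (fst (m g))) - 1" for g
  have minus1: "real (card ({k \<in> H. fst k = fst h} - {h})) = real (d (fst h)) - 1" if "h \<in> H" for h
  proof -
    have "card ({k \<in> H. fst k = fst h} - {h}) + 1 = d (fst h)"
      using card_Suc_Diff1[of "{k \<in> H. fst k = fst h}" h] fin that deg[OF that] by simp
    then show ?thesis by linarith
  qed
  have "loop_pairs H = (SIGMA e:H. {k \<in> H. fst k = fst e} - {e})"
    by (auto simp: loop_pairs_def distinct_pairs_def)
  then have "real (card (loop_pairs H)) = (\<Sum>g\<in>H. a g)"
    using fin minus1 by (simp add: card_SigmaI a_def)
  moreover have "(\<Sum>g\<in>H. b g) = (\<Sum>g\<in>H. a g)"
    using M by (intro sum.reindex_bij_witness[of H m m]) (auto simp: a_def b_def)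
  ultimately have loops: "2 * real (card (loop_pairs H)) = (\<Sum>g\<in>H. a g + b g)"
    by (simp add: sum.distrib)
  let ?S = "SIGMA g:H. ({k \<in> H. fst k = fst g} - {g}) \<times> ({k \<in> H. fst k = fst (m g)} - {m g})"
  have finS: "finite ?S" using fin by auto
  have "parallel_pairs H m \<subseteq> snd ` ?S"
    by (force simp: parallel_pairs_def)
  then have "card (parallel_pairs H m) \<le> card ?S"
    using finS by (meson card_image_le card_mono finite_imageI order_trans)
  moreover have "real (card ?S) = (\<Sum>g\<in>H. a g * b g)"
    using fin minus1 M by (simp add: card_SigmaI card_cartesian_product a_def b_def)
  ultimately have par: "real (card (parallel_pairs H m)) \<le> (\<Sum>g\<in>H. a g * b g)"
    by linarith
  let ?L = "loop_pairs H" and ?P = "parallel_pairs H m"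
  have finLP: "finite ?L" "finite ?P"
    using fin by (auto simp: loop_pairs_def parallel_pairs_def distinct_pairs_def intro: finite_subset[of _ "H \<times> H"])
  have "card (blocked_pairs H m) \<le> card (?L \<union> map_prod m m ` ?L \<union> ?P \<union> map_prod m m ` ?P)"
    using blocked_pairs_subset[OF fin m] finLP by (intro card_mono) auto
  also have "\<dots> \<le> card ?L + card (map_prod m m ` ?L) + card ?P + card (map_prod m m ` ?P)"
    by (meson add_mono card_Un_le le_refl order_trans)
  also have "\<dots> \<le> card ?L + card ?L + card ?P + card ?P"
    using finLP by (intro add_mono card_image_le) auto
  finally have "real (card (blocked_pairs H m)) \<le> 2 * real (card ?L) + 2 * real (card ?P)"
    by linarith
  also have "\<dots> \<le> (\<Sum>g\<in>H. a g + b g + 2 * (a g * b g))"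
    using par by (simp add: loops sum.distrib flip: sum_distrib_left)
  finally show ?thesis by (simp add: a_def b_def algebra_simps)
qed

section \<open>Simple matchings of a graphical degree sequence\<close>

text \<open>At each vertex of a realising graph, number the incident edges by the half-edges available there, and match
  the two half-edges that carry the same edge.\<close>

lemma simple_matchings_nonempty:
  assumes "graphical n D"
  shows "simple_matchings (half_edges n D) \<noteq> {}"
proof -
  from assms obtain E
    where E': "\<forall>e\<in>E. e \<subseteq> {1..n} \<and> card e = 2" and deg': "\<forall>i\<in>{1..n}. card {e \<in> E. i \<in> e} = D i"
    unfolding graphical_def by (elim exE conjE)
  have E: "e \<subseteq> {1..n} \<and> card e = 2" if "e \<in> E" for e using E' that by (rule bspec)
  have deg: "card {e \<in> E. i \<in> e} = D i" if "i \<in> {1..n}" for i using deg' that by (rule bspec)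
  define I where "I i = {e \<in> E. i \<in> e}" for i
  have finE: "finite E" using E by (intro finite_subset[of E "Pow {1..n}"]) auto
  have "\<exists>b. bij_betw b (I i) {..<D i}" if "i \<in> {1..n}" for i
    using deg[OF that] finE by (intro finite_same_card_bij) (auto simp: I_def)
  then obtain b where b: "\<And>i. i \<in> {1..n} \<Longrightarrow> bij_betw (b i) (I i) {..<D i}"
    by metis
  let ?H = "half_edges n D"
  define edge where "edge h = inv_into (I (fst h)) (b (fst h)) (snd h)" for h
  define far where "far h = the_elem (edge h - {fst h})" for h
  define m where "m h = (if h \<in> ?H then (far h, b (far h) (edge h)) else h)" for h
  have edge_I: "edge h \<in> I (fst h)" and b_edge: "b (fst h) (edge h) = snd h" if "h \<in> ?H" for h
  proof -
    have h: "fst h \<in> {1..n}" "snd h \<in> {..<D (fst h)}" using that by (auto simp: half_edges_def)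
    then have "snd h \<in> b (fst h) ` I (fst h)" using b by (simp add: bij_betw_def)
    then show "edge h \<in> I (fst h)" "b (fst h) (edge h) = snd h"
      by (auto simp: edge_def inv_into_into f_inv_into_f)
  qed
  have edge_b: "edge (i, b i e) = e" if "i \<in> {1..n}" "e \<in> I i" for i e
    using b[OF that(1)] that(2) by (simp add: edge_def bij_betw_inv_into_left)
  have edge_eq: "edge h = {fst h, far h}" and far_ne: "far h \<noteq> fst h" if "h \<in> ?H" for h
  proof -
    have "fst h \<in> edge h" "card (edge h) = 2" using edge_I[OF that] E by (auto simp: I_def)
    then obtain j where "edge h = {fst h, j}" "j \<noteq> fst h"
      by (auto simp: card_2_iff insert_commute)
    moreover from this have "edge h - {fst h} = {j}" by auto
    ultimately show "edge h = {fst h, far h}" "far h \<noteq> fst h" by (auto simp: far_def)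
  qed
  have far_range: "far h \<in> {1..n}" and edge_far: "edge h \<in> I (far h)" if "h \<in> ?H" for h
    using edge_I[OF that] E[of "edge h"] edge_eq[OF that] by (auto simp: I_def)
  have m_H: "m h \<in> ?H" and edge_m: "edge (m h) = edge h" if "h \<in> ?H" for h
  proof -
    have "b (far h) (edge h) \<in> {..<D (far h)}"
      using b[OF far_range[OF that]] edge_far[OF that] by (auto simp: bij_betw_def)
    then show "m h \<in> ?H" using far_range[OF that] that by (auto simp: m_def half_edges_def)
    show "edge (m h) = edge h"
      using edge_b[OF far_range[OF that] edge_far[OF that]] that by (simp add: m_def)
  qed
  have fst_m: "fst (m h) = far h" if "h \<in> ?H" for h using that by (simp add: m_def)
  have inv: "m (m h) = h" for h
  proof (cases "h \<in> ?H")
    case True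
    have "{fst h, far h} = {far h, far (m h)}"
      using edge_eq[OF True] edge_eq[OF m_H[OF True]] edge_m[OF True] fst_m[OF True] by simp
    then have "far (m h) = fst h" using far_ne[OF True] by (auto simp: doubleton_eq_iff)
    then have "m (m h) = (fst h, b (fst h) (edge h))"
      using m_H[OF True] edge_m[OF True] by (simp add: m_def[of "m h"])
    then show ?thesis using b_edge[OF True] by simp
  qed (simp add: m_def)
  have "m permutes ?H"
    unfolding permutes_def using inv by (metis m_def)
  then have "m \<in> perfect_matchings ?H"
    using inv fst_m far_ne by (fastforce simp: perfect_matchings_def)
  moreover have "e = f" if "e \<in> ?H" "f \<in> ?H" "fst e = fst f" "fst (m e) = fst (m f)" for e f
  proof -
    have "edge e = edge f" using that edge_eq fst_m by metis
    then have "snd e = snd f" using that b_edge by metis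
    then show ?thesis using that by (simp add: prod_eq_iff)
  qed
  moreover have "finite ?H" by (simp add: half_edges_def)
  ultimately have "m \<in> simple_matchings ?H"
    using fst_m far_ne by (auto simp: simple_matchings_iff)
  then show ?thesis by blast
qed

section \<open>Summation over the edges of a simple graph\<close>

text \<open>Elements of \<open>S\<close> beyond \<open>i + d\<close> can be traded for missing elements of the initial segment: there are at least
  as many of the latter, and the value at \<open>i + d\<close> separates the two groups.\<close>

lemma sum_antitone_le_initial_segment:
  fixes w :: "nat \<Rightarrow> real"
  assumes S: "S \<subseteq> {i+1..n}" "card S \<le> d"
    and anti: "\<And>j k. i < j \<Longrightarrow> j \<le> k \<Longrightarrow> k \<le> n \<Longrightarrow> w k \<le> w j"
    and nonneg: "\<And>j. 0 \<le> w j"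
  shows "sum w S \<le> (\<Sum>j\<in>{j \<in> {i+1..i+d}. j \<le> n}. w j)"
proof -
  let ?T = "{j \<in> {i+1..i+d}. j \<le> n}"
  have finS: "finite S" using S(1) finite_subset by blast
  show ?thesis
  proof (cases "n \<le> i + d")
    case True
    then have "S \<subseteq> ?T" using S(1) by auto
    then show ?thesis using nonneg by (intro sum_mono2) auto
  next
    case False
    then have "?T = {i+1..i+d}" by auto
    then have "card S \<le> card ?T" using S(2) by simp
    then have "card (S - ?T) \<le> card (?T - S)"
      using card_Diff_subset_Int[of S ?T] card_Diff_subset_Int[of ?T S] finS by (simp add: Int_commute)
    have "sum w (S - ?T) \<le> real (card (S - ?T)) * w (i + d)"
    proof (cases "d = 0")
      case True
      then show ?thesis using S(2) finS by simp
    next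
      case d: False
      have "w j \<le> w (i + d)" if "j \<in> S - ?T" for j
        using that S(1) d by (intro anti) auto
      then show ?thesis by (rule sum_bounded_above)
    qed
    also have "\<dots> \<le> real (card (?T - S)) * w (i + d)"
      using \<open>card (S - ?T) \<le> _\<close> nonneg by (intro mult_right_mono) auto
    also have "\<dots> \<le> sum w (?T - S)"
      using False by (intro sum_bounded_below anti) auto
    finally have "sum w (S - ?T) \<le> sum w (?T - S)" .
    moreover have "sum w S = sum w (S \<inter> ?T) + sum w (S - ?T)"
      using finS by (rule sum.Int_Diff)
    moreover have "sum w ?T = sum w (?T \<inter> S) + sum w (?T - S)"
      by (rule sum.Int_Diff) simp
    ultimately show ?thesis by (simp add: Int_commute)
  qed
qed

text \<open>Each edge is seen from both of its half-edges, which gives the factor 2; counting it at its smaller end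
  leaves for each \<open>i\<close> a sum over distinct later neighbours, at most \<open>D i\<close> in number.\<close>

lemma sum_half_edges_le:
  fixes D :: "nat \<Rightarrow> nat"
  defines "w \<equiv> (\<lambda>i j. 2 * real (D i) * real (D j) - real (D i) - real (D j))"
  assumes anti: "\<And>i j. 1 \<le> i \<Longrightarrow> i \<le> j \<Longrightarrow> j \<le> n \<Longrightarrow> D j \<le> D i"
    and m: "m \<in> simple_matchings (half_edges n D)"
  shows "(\<Sum>g\<in>half_edges n D. w (fst g) (fst (m g)))
    \<le> 2 * (\<Sum>i=1..n - 1. \<Sum>j\<in>{j \<in> {i+1..i + D i}. j \<le> n \<and> 0 < D j}. w i j)"
proof -
  let ?H = "half_edges n D"
  have fin: "finite ?H" by (simp add: half_edges_def)
  have pm: "m \<in> perfect_matchings ?H" and noloop: "\<And>h. h \<in> ?H \<Longrightarrow> fst (m h) \<noteq> fst h"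
    and nopar: "\<And>h k. h \<in> ?H \<Longrightarrow> k \<in> ?H \<Longrightarrow> fst h = fst k \<Longrightarrow> fst (m h) = fst (m k) \<Longrightarrow> h = k"
    using m by (auto simp: simple_matchings_iff[OF fin])
  note M = perfect_matchingsD[OF pm]
  let ?W = "\<lambda>g. w (fst g) (fst (m g))"
  let ?U = "{g \<in> ?H. fst g < fst (m g)}" and ?V = "{g \<in> ?H. fst (m g) < fst g}"
  let ?T = "\<lambda>i. \<Sum>j\<in>{j \<in> {i+1..i + D i}. j \<le> n \<and> 0 < D j}. w i j"
  have "sum ?W ?V = sum ?W ?U"
    using M by (intro sum.reindex_bij_witness[of _ m m]) (auto simp: w_def)
  moreover have "sum ?W ?H = sum ?W (?U \<union> ?V)"
    using noloop by (intro sum.cong) (auto simp: less_le)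
  moreover have "sum ?W (?U \<union> ?V) = sum ?W ?U + sum ?W ?V"
    using fin by (intro sum.union_disjoint) auto
  ultimately have half: "sum ?W ?H = 2 * sum ?W ?U" by simp
  have local_sum: "(\<Sum>g\<in>{g \<in> ?U. fst g = i}. ?W g) \<le> ?T i" for i
  proof (cases "D i = 0")
    case True
    then have no_edges: "{g \<in> ?U. fst g = i} = {}" by (auto simp: half_edges_def)
    show ?thesis unfolding no_edges using True by simp
  next
    case False
    let ?N = "(\<lambda>g. fst (m g)) ` {g \<in> ?U. fst g = i}"
    \<comment> \<open>the weight would be negative at vertices of degree 0, which are never neighbours; replacing
      it by 0 there makes it nonnegative and keeps it antitone\<close>
    define w' where "w' j = (if 0 < D j then w i j else 0)" for j
    have deg: "0 < D (fst (m g)) \<and> fst (m g) \<le> n \<and> 1 \<le> i" if "g \<in> {g \<in> ?U. fst g = i}" for g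
      using that M(2)[of g] by (cases "m g") (auto simp: half_edges_def)
    have "(\<Sum>g\<in>{g \<in> ?U. fst g = i}. ?W g) = (\<Sum>g\<in>{g \<in> ?U. fst g = i}. w' (fst (m g)))"
      using deg by (intro sum.cong) (auto simp: w'_def)
    also have "\<dots> = sum w' ?N"
      using nopar by (subst sum.reindex) (auto simp: inj_on_def)
    also have "\<dots> \<le> (\<Sum>j\<in>{j \<in> {i+1..i + D i}. j \<le> n}. w' j)"
    proof (rule sum_antitone_le_initial_segment)
      show "?N \<subseteq> {i+1..n}" using deg by auto
      have "card ?N \<le> card {g \<in> ?U. fst g = i}" using fin by (intro card_image_le) auto
      also have "\<dots> \<le> card (Pair i ` {..<D i})"
        by (intro card_mono) (auto simp: half_edges_def)
      also have "\<dots> \<le> D i" by (metis card_image_le card_lessThan finite_lessThan)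
      finally show "card ?N \<le> D i" .
    next
      have w_eq: "w i j = (2 * real (D i) - 1) * real (D j) - real (D i)" for j
        by (simp add: w_def algebra_simps)
      show nonneg: "0 \<le> w' j" for j
      proof (cases "0 < D j")
        case True
        have "real (D i) \<le> (2 * real (D i) - 1) * 1"
          using False by simp
        also have "\<dots> \<le> (2 * real (D i) - 1) * real (D j)"
          using False True by (intro mult_left_mono) auto
        finally have "real (D i) \<le> (2 * real (D i) - 1) * real (D j)" .
        then show ?thesis using True by (simp add: w'_def w_eq)
      qed (simp add: w'_def)
      show "w' k \<le> w' j" if "i < j" "j \<le> k" "k \<le> n" for j k
      proof (cases "0 < D k")
        case True
        have "D k \<le> D j" using that by (intro anti) auto
        then have "(2 * real (D i) - 1) * real (D k) \<le> (2 * real (D i) - 1) * real (D j)"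
          using False by (intro mult_left_mono) auto
        then show ?thesis using True \<open>D k \<le> D j\<close> by (simp add: w'_def w_eq)
      qed (use nonneg[of j] in \<open>simp add: w'_def\<close>)
    qed
    also have "\<dots> = ?T i"
      by (rule sum.mono_neutral_cong_right) (auto simp: w'_def)
    finally show ?thesis .
  qed
  have "sum ?W ?U = (\<Sum>i=1..n. \<Sum>g\<in>{g \<in> ?U. fst g = i}. ?W g)"
    using fin by (intro sum.group[symmetric]) (auto simp: half_edges_def)
  also have "\<dots> \<le> (\<Sum>i=1..n. ?T i)" by (intro sum_mono local_sum)
  also have "\<dots> = (\<Sum>i=1..n - 1. ?T i)"
    by (intro sum.mono_neutral_right) (auto intro!: sum.neutral)
  finally show ?thesis using half by simp
qed

section \<open>The coupled switch chain\<close>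

definition simple_switch :: "('v \<times> 'b) set \<Rightarrow> 'v \<times> 'b \<Rightarrow> 'v \<times> 'b \<Rightarrow> ('v \<times> 'b \<Rightarrow> 'v \<times> 'b) \<Rightarrow> 'v \<times> 'b \<Rightarrow> 'v \<times> 'b" where
  "simple_switch H e f m = (if switch e f m \<in> simple_matchings H then switch e f m else m)"

lemma uniform_switch_step:
  assumes "finite H" "distinct_pairs H \<noteq> {}" "perfect_matchings H \<noteq> {}"
  shows "pmf_of_set (perfect_matchings H) \<bind>
      (\<lambda>m. map_pmf (\<lambda>(e, f). switch e f m) (pmf_of_set (distinct_pairs H)))
    = pmf_of_set (perfect_matchings H)"
proof -
  let ?T = "\<lambda>(m, e, f). (switch e f m, e, m e)"
  have T: "?T z \<in> perfect_matchings H \<times> distinct_pairs H \<and> ?T (?T z) = z"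
    if "z \<in> perfect_matchings H \<times> distinct_pairs H" for z
  proof -
    obtain m e f where z: "z = (m, e, f)" by (cases z)
    with that have m: "m \<in> perfect_matchings H" and ef: "e \<in> H" "f \<in> H" "e \<noteq> f"
      by (auto simp: distinct_pairs_def)
    show ?thesis
      using perfect_matchingsD(2)[OF m, of e] perfect_matchingsD(3)[OF m, of e] ef m
      by (auto simp: z distinct_pairs_def switch_in_perfect_matchings switch_switch[OF m ef] switch_apply[OF m ef])
  qed
  have "(\<lambda>p. fst (?T (m, p))) = (\<lambda>(e, f). switch e f m)" for m :: "'a \<Rightarrow> 'a"
    by auto
  then show ?thesis
    using uniform_step_of_involution[of "perfect_matchings H" "distinct_pairs H" ?T] T
      finite_perfect_matchings[OF assms(1)] finite_distinct_pairs[OF assms(1)] assms by simp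
qed

text \<open>Skipping a switch fixes the triple \<open>(m, e, f)\<close>, and a permitted switch leads to a triple whose switch
  restores \<open>m\<close> and is therefore permitted too; the map on triples remains an involution.\<close>

lemma uniform_simple_switch_step:
  assumes "finite H" "distinct_pairs H \<noteq> {}" "simple_matchings H \<noteq> {}"
  shows "pmf_of_set (simple_matchings H) \<bind>
      (\<lambda>m. map_pmf (\<lambda>(e, f). simple_switch H e f m) (pmf_of_set (distinct_pairs H)))
    = pmf_of_set (simple_matchings H)"
proof -
  let ?T = "\<lambda>(m, e, f). if switch e f m \<in> simple_matchings H then (switch e f m, e, m e) else (m, e, f)"
  have pm: "m \<in> perfect_matchings H" if "m \<in> simple_matchings H" for m
    using that by (simp add: simple_matchings_def)
  have T: "?T z \<in> simple_matchings H \<times> distinct_pairs H \<and> ?T (?T z) = z"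
    if "z \<in> simple_matchings H \<times> distinct_pairs H" for z
  proof -
    obtain m e f where z: "z = (m, e, f)" by (cases z)
    with that have sm: "m \<in> simple_matchings H" and ef: "e \<in> H" "f \<in> H" "e \<noteq> f"
      by (auto simp: distinct_pairs_def)
    note m = pm[OF sm]
    show ?thesis
      using perfect_matchingsD(2)[OF m, of e] perfect_matchingsD(3)[OF m, of e] ef sm
      by (auto simp: z distinct_pairs_def switch_switch[OF m ef] switch_apply[OF m ef])
  qed
  have "(\<lambda>p. fst (?T (m, p))) = (\<lambda>(e, f). simple_switch H e f m)" for m
    by (auto simp: simple_switch_def)
  moreover have "finite (simple_matchings H)"
    using finite_perfect_matchings[OF assms(1)] pm by (meson finite_subset subsetI)
  ultimately show ?thesis
    using uniform_step_of_involution[of "simple_matchings H" "distinct_pairs H" ?T] T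
      finite_distinct_pairs[OF assms(1)] assms by simp
qed

text \<open>The term \<open>N * (N - 1)\<close> counts the ordered pairs of distinct half-edges on which \<open>x\<close> and \<open>y\<close> both disagree,
  each of which contributes a gain of 2.\<close>

lemma sum_switch_num_differing_le:
  assumes fin: "finite H"
    and x: "x \<in> perfect_matchings H" and y: "y \<in> simple_matchings H"
  defines "N \<equiv> real (num_differing H x y)"
  shows "(\<Sum>(e, f)\<in>distinct_pairs H. real (num_differing H (switch e f x) (simple_switch H e f y)))
    \<le> real (card (distinct_pairs H)) * N - 2 * (N * (N - 1)) + 4 * real (card (blocked_pairs H y))"
proof -
  let ?P = "distinct_pairs H"
  let ?B = "{h \<in> H. x h \<noteq> y h}"
  have y': "y \<in> perfect_matchings H" using y by (simp add: simple_matchings_def)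
  have finP: "finite ?P" using fin by (rule finite_distinct_pairs)
  have step: "real (num_differing H (switch e f x) (simple_switch H e f y))
      \<le> N - 2 * of_bool ((e, f) \<in> distinct_pairs ?B) + 4 * of_bool ((e, f) \<in> blocked_pairs H y)"
    if "(e, f) \<in> ?P" for e f
  proof -
    have ef: "e \<in> H" "f \<in> H" "e \<noteq> f" using that by (auto simp: distinct_pairs_def)
    have both: "(e, f) \<in> distinct_pairs ?B \<longleftrightarrow> x e \<noteq> y e \<and> x f \<noteq> y f"
      using ef by (auto simp: distinct_pairs_def)
    show ?thesis
    proof (cases "switch e f y \<in> simple_matchings H")
      case True
      then have "(e, f) \<notin> blocked_pairs H y" "simple_switch H e f y = switch e f y"
        by (auto simp: blocked_pairs_def simple_switch_def)
      then show ?thesis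
        using num_differing_switch_le[OF fin x y' ef] unfolding both N_def by (auto split: if_splits)
    next
      case False
      then have "(e, f) \<in> blocked_pairs H y" "simple_switch H e f y = y"
        using that by (auto simp: blocked_pairs_def simple_switch_def)
      then show ?thesis
        using num_differing_switch_left_le[OF fin x y' ef] unfolding both N_def by (auto split: if_splits)
    qed
  qed
  have bool_sum: "(\<Sum>p\<in>?P. of_bool (p \<in> Q)) = real (card Q)" if "Q \<subseteq> ?P" for Q
    using that finP by (simp add: of_bool_def sum.If_cases Int_absorb1)
  have "distinct_pairs ?B \<subseteq> ?P" by (auto simp: distinct_pairs_def)
  moreover have "real (card (distinct_pairs ?B)) = N * (N - 1)"
    using fin by (cases "card ?B") (auto simp: card_distinct_pairs N_def num_differing_def algebra_simps)
  ultimately have both_sum: "(\<Sum>p\<in>?P. of_bool (p \<in> distinct_pairs ?B)) = N * (N - 1)"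
    using bool_sum by simp
  have blocked_sum: "(\<Sum>p\<in>?P. of_bool (p \<in> blocked_pairs H y)) = real (card (blocked_pairs H y))"
    by (rule bool_sum) (auto simp: blocked_pairs_def)
  have "(\<Sum>(e, f)\<in>?P. real (num_differing H (switch e f x) (simple_switch H e f y)))
    \<le> (\<Sum>p\<in>?P. N - 2 * of_bool (p \<in> distinct_pairs ?B) + 4 * of_bool (p \<in> blocked_pairs H y))"
  proof (rule sum_mono)
    fix p assume "p \<in> ?P"
    then show "(case p of (e, f) \<Rightarrow> real (num_differing H (switch e f x) (simple_switch H e f y)))
      \<le> N - 2 * of_bool (p \<in> distinct_pairs ?B) + 4 * of_bool (p \<in> blocked_pairs H y)"
      using step[of "fst p" "snd p"] by (simp only: split_def prod.collapse)
  qed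
  also have "\<dots> = real (card ?P) * N - 2 * (N * (N - 1)) + 4 * real (card (blocked_pairs H y))"
    by (simp add: sum.distrib sum_subtractf both_sum blocked_sum flip: sum_distrib_left)
  finally show ?thesis .
qed

text \<open>Let a coupling with the smallest expected number of disagreements make one step of the chain.
  The expectation cannot decrease, so the expected gain is bounded by the expected cost of blocked switches.\<close>

lemma exists_coupling_num_differing_le:
  assumes fin: "finite H" and ne: "simple_matchings H \<noteq> {}"
    and blocked: "\<And>y. y \<in> simple_matchings H \<Longrightarrow> real (card (blocked_pairs H y)) \<le> C"
  shows "\<exists>\<mu>. map_pmf fst \<mu> = pmf_of_set (perfect_matchings H) \<and>
    map_pmf snd \<mu> = pmf_of_set (simple_matchings H) \<and>
    measure_pmf.expectation \<mu> (\<lambda>(x, y). real (num_differing H x y) * (real (num_differing H x y) - 1)) \<le> 2 * C"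
proof -
  let ?A = "perfect_matchings H" and ?B = "simple_matchings H" and ?P = "distinct_pairs H"
  have sub: "?B \<subseteq> ?A" by (auto simp: simple_matchings_def)
  have finA: "finite ?A" using fin by (rule finite_perfect_matchings)
  have finB: "finite ?B" using sub finA by (rule finite_subset)
  have finP: "finite ?P" using fin by (rule finite_distinct_pairs)
  have neA: "?A \<noteq> {}" using sub ne by auto
  define N where "N = (\<lambda>(x, y). real (num_differing H x y))"
  obtain \<mu> where \<mu>: "map_pmf fst \<mu> = pmf_of_set ?A" "map_pmf snd \<mu> = pmf_of_set ?B"
    and opt: "\<And>\<nu>. map_pmf fst \<nu> = pmf_of_set ?A \<Longrightarrow> map_pmf snd \<nu> = pmf_of_set ?B \<Longrightarrow>
      measure_pmf.expectation \<mu> N \<le> measure_pmf.expectation \<nu> N"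
    using exists_optimal_coupling[of "pmf_of_set ?A" "pmf_of_set ?B" N] finA finB ne neA by auto
  have supp: "set_pmf \<mu> \<subseteq> ?A \<times> ?B"
    using set_pmf_coupling_subset[OF \<mu>] finA finB ne neA by simp
  have E: "measure_pmf.expectation \<mu> h = (\<Sum>z\<in>?A \<times> ?B. pmf \<mu> z * h z)" for h :: "_ \<Rightarrow> real"
    using supp finA finB by (subst integral_measure_pmf[of "?A \<times> ?B"]) auto
  have total: "(\<Sum>z\<in>?A \<times> ?B. pmf \<mu> z) = 1"
    using supp finA finB by (intro sum_pmf_eq_1) auto
  obtain y0 where "y0 \<in> ?B" using ne by blast
  then have C: "0 \<le> C" using blocked[of y0] by linarith
  have "(\<Sum>z\<in>?A \<times> ?B. pmf \<mu> z * (2 * (N z * (N z - 1)) - 4 * C)) \<le> 0"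
  proof (cases "?P = {}")
    case True
    \<comment> \<open>with fewer than two half-edges there is no pair to draw, and \<open>N\<close> is at most 1\<close>
    have agree: "N z * (N z - 1) = 0" for z
    proof -
      obtain x y where z: "z = (x, y)" by (cases z)
      have "card {h \<in> H. x h \<noteq> y h} * (card {h \<in> H. x h \<noteq> y h} - 1) = card (distinct_pairs {h \<in> H. x h \<noteq> y h})"
        using fin by (simp add: card_distinct_pairs)
      also have "distinct_pairs {h \<in> H. x h \<noteq> y h} = {}" using True by (auto simp: distinct_pairs_def)
      finally have "num_differing H x y = 0 \<or> num_differing H x y = 1"
        by (auto simp: num_differing_def)
      then show ?thesis by (auto simp: N_def z)
    qed
    show ?thesis
      unfolding agree using C by (intro sum_nonpos mult_nonneg_nonpos) auto
  next
    case neP: False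
    define step where "step = (\<lambda>(x, y) (e, f). (switch e f x, simple_switch H e f y))"
    define \<nu> where "\<nu> = \<mu> \<bind> (\<lambda>z. map_pmf (step z) (pmf_of_set ?P))"
    have "map_pmf fst \<nu> = map_pmf fst \<mu> \<bind> (\<lambda>x. map_pmf (\<lambda>(e, f). switch e f x) (pmf_of_set ?P))"
      unfolding \<nu>_def map_bind_pmf bind_map_pmf map_pmf_comp by (simp add: step_def split_def)
    also have "\<dots> = pmf_of_set ?A"
      unfolding \<mu> using fin neP neA by (rule uniform_switch_step)
    finally have \<nu>1: "map_pmf fst \<nu> = pmf_of_set ?A" .
    have "map_pmf snd \<nu> = map_pmf snd \<mu> \<bind> (\<lambda>y. map_pmf (\<lambda>(e, f). simple_switch H e f y) (pmf_of_set ?P))"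
      unfolding \<nu>_def map_bind_pmf bind_map_pmf map_pmf_comp by (simp add: step_def split_def)
    also have "\<dots> = pmf_of_set ?B"
      unfolding \<mu> using fin neP ne by (rule uniform_simple_switch_step)
    finally have \<nu>2: "map_pmf snd \<nu> = pmf_of_set ?B" .
    have cardP: "0 < real (card ?P)" using finP neP by (simp add: card_gt_0_iff)
    have "measure_pmf.expectation \<mu> N \<le> measure_pmf.expectation \<nu> N"
      using opt \<nu>1 \<nu>2 .
    also have "\<dots> = (\<Sum>z\<in>?A \<times> ?B. pmf \<mu> z * ((\<Sum>p\<in>?P. N (step z p)) / card ?P))"
      unfolding \<nu>_def using finA finB finP neP supp
      by (subst pmf_expectation_bind[of "?A \<times> ?B"]) (auto simp: integral_pmf_of_set)
    also have "\<dots> \<le> (\<Sum>z\<in>?A \<times> ?B. pmf \<mu> z * (N z - (2 * (N z * (N z - 1)) - 4 * C) / card ?P))"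
    proof (intro sum_mono mult_left_mono)
      fix z assume "z \<in> ?A \<times> ?B"
      then obtain x y where z: "z = (x, y)" "x \<in> ?A" "y \<in> ?B" by blast
      have "(\<Sum>p\<in>?P. N (step z p)) = (\<Sum>(e, f)\<in>?P. real (num_differing H (switch e f x) (simple_switch H e f y)))"
        by (simp add: N_def step_def z split_def)
      also have "\<dots> \<le> real (card ?P) * N z - 2 * (N z * (N z - 1)) + 4 * C"
        using sum_switch_num_differing_le[OF fin z(2,3)] blocked[OF z(3)] by (simp add: N_def z(1))
      finally show "(\<Sum>p\<in>?P. N (step z p)) / card ?P \<le> N z - (2 * (N z * (N z - 1)) - 4 * C) / card ?P"
        using cardP by (simp add: field_simps)
    qed simp
    also have "\<dots> = measure_pmf.expectation \<mu> N - (\<Sum>z\<in>?A \<times> ?B. pmf \<mu> z * (2 * (N z * (N z - 1)) - 4 * C)) / card ?P"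
      unfolding E sum_divide_distrib sum_subtractf[symmetric]
      by (intro sum.cong) (auto simp: diff_divide_distrib algebra_simps)
    finally show ?thesis using cardP by (simp add: divide_le_0_iff zero_le_divide_iff)
  qed
  also have "(\<Sum>z\<in>?A \<times> ?B. pmf \<mu> z * (2 * (N z * (N z - 1)) - 4 * C))
    = 2 * (\<Sum>z\<in>?A \<times> ?B. pmf \<mu> z * (N z * (N z - 1))) - 4 * C * (\<Sum>z\<in>?A \<times> ?B. pmf \<mu> z)"
    unfolding sum_distrib_left sum_subtractf[symmetric] by (intro sum.cong) (auto simp: algebra_simps)
  also have "\<dots> = 2 * measure_pmf.expectation \<mu> (\<lambda>z. N z * (N z - 1)) - 4 * C"
    by (simp only: total E mult_1_right)
  finally have "measure_pmf.expectation \<mu> (\<lambda>z. N z * (N z - 1)) \<le> 2 * C" by linarith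
  moreover have "(\<lambda>z. N z * (N z - 1)) = (\<lambda>(x, y). real (num_differing H x y) * (real (num_differing H x y) - 1))"
    by (auto simp: N_def)
  ultimately have "measure_pmf.expectation \<mu>
    (\<lambda>(x, y). real (num_differing H x y) * (real (num_differing H x y) - 1)) \<le> 2 * C" by (simp only:)
  then show ?thesis using \<mu> by blast
qed

theorem proposition1p4:
  fixes n E :: nat and D :: "nat \<Rightarrow> nat"
  assumes "graphical n D"
    and "\<And>i j. 1 \<le> i \<Longrightarrow> i \<le> j \<Longrightarrow> j \<le> n \<Longrightarrow> D j \<le> D i"
    and "2 * E = (\<Sum>i=1..n. D i)"
  shows "\<exists>\<mu>. matching_coupling n D \<mu> \<and>
    (\<forall>(x, y) \<in> set_pmf \<mu>. num_differing (half_edges n D) x y \<le> 2 * E) \<and>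
    measure_pmf.expectation \<mu>
      (\<lambda>(x, y). real (num_differing (half_edges n D) x y) *
                (real (num_differing (half_edges n D) x y) - 1))
    \<le> 4 * (\<Sum>i=1..n - 1. \<Sum>j\<in>{j \<in> {i+1..i + D i}. j \<le> n \<and> 0 < D j}.
             2 * real (D i) * real (D j) - real (D i) - real (D j))"
proof -
  let ?H = "half_edges n D"
  let ?S = "\<Sum>i=1..n - 1. \<Sum>j\<in>{j \<in> {i+1..i + D i}. j \<le> n \<and> 0 < D j}.
             2 * real (D i) * real (D j) - real (D i) - real (D j)"
  have fin: "finite ?H" by (simp add: half_edges_def)
  have deg: "card {k \<in> ?H. fst k = fst h} = D (fst h)" if "h \<in> ?H" for h
  proof -
    have "{k \<in> ?H. fst k = fst h} = Pair (fst h) ` {..<D (fst h)}"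
      using that by (auto simp: half_edges_def)
    then show ?thesis by (simp add: card_image inj_on_def)
  qed
  have blocked: "real (card (blocked_pairs ?H y)) \<le> 2 * ?S" if "y \<in> simple_matchings ?H" for y
    using card_blocked_pairs_le[OF fin that deg] sum_half_edges_le[OF assms(2) that]
    by linarith
  obtain \<mu> where \<mu>: "map_pmf fst \<mu> = pmf_of_set (perfect_matchings ?H)"
      "map_pmf snd \<mu> = pmf_of_set (simple_matchings ?H)"
    and bound: "measure_pmf.expectation \<mu>
      (\<lambda>(x, y). real (num_differing ?H x y) * (real (num_differing ?H x y) - 1)) \<le> 2 * (2 * ?S)"
    using exists_coupling_num_differing_le[OF fin simple_matchings_nonempty[OF assms(1)] blocked] by blast
  have "num_differing ?H x y \<le> card ?H" for x y
    unfolding num_differing_def using fin by (intro card_mono) auto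
  also have "card ?H = 2 * E"
    by (simp add: half_edges_def card_SigmaI assms(3))
  finally have "num_differing ?H x y \<le> 2 * E" for x y .
  then show ?thesis
    using \<mu> bound by (intro exI[of _ \<mu>]) (auto simp: matching_coupling_def)
qed

end
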